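(* Let $q$ be a prime power, let $\pi$ be the plane $x_4=0$ and $T=\langle(0,0,0,1)\rangle$ in ${\rm PG}(3,q)$, and let $C$ be the group defined in the context. Then $C$ has $q+1$ orbits, each of size $q^3-1$, on the lines of ${\rm PG}(3,q)$ not contained in $\pi$ and not passing through $T$, and $C$ acts semiregularly on the $q^3-1$ points of ${\rm PG}(3,q)\setminus(\pi\cup\{T\})$.
   Context: Points of ${\rm PG}(3,q)$ are $\langle(x_1,x_2,x_3,x_4)\rangle$ (column vectors, matrices acting on the left). Let $\sigma\in{\rm GL}(3,q)$ be a Singer cycle (element of order $q^3-1$). $C$ is the group of projectivities of ${\rm PG}(3,q)$ induced by the matrices $\begin{pmatrix} A & 0\\ 0 & 1\end{pmatrix}$ with $A\in\langle\sigma\rangle$; it has order $q^3-1$, fixes $T$ and $\pi$, induces on $\pi$ a Singer cyclic group $C_1$ of ${\rm PGL}(3,q)$ (order $q^2+q+1$), and contains the $q-1$ homologies with centre $T$ and axis $\pi$. *)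

theory Defs
  imports "Jordan_Normal_Form.Matrix"
begin

text \<open>Vectors of the ambient space F_q^4 (coordinates x1..x4 are indices 0..3).\<close>
definition V4 :: "'a::field vec set" where
  "V4 = carrier_vec 4"

text \<open>Points of PG(3,q): 1-dimensional subspaces of F^4.\<close>
definition pg_points :: "'a::field vec set set" where
  "pg_points = {S. \<exists>v\<in>V4. v \<noteq> 0\<^sub>v 4 \<and> S = {c \<cdot>\<^sub>v v | c. True}}"

text \<open>Lines of PG(3,q): 2-dimensional subspaces of F^4.\<close>
definition pg_lines :: "'a::field vec set set" where
  "pg_lines = {S. \<exists>u\<in>V4. \<exists>w\<in>V4.
      (\<forall>a b. a \<cdot>\<^sub>v u + b \<cdot>\<^sub>v w = 0\<^sub>v 4 \<longrightarrow> a = 0 \<and> b = 0) \<and>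
      S = {a \<cdot>\<^sub>v u + b \<cdot>\<^sub>v w | a b. True}}"

text \<open>The plane pi: x4 = 0 (as a set of vectors), and the point T = <(0,0,0,1)>.\<close>
definition plane_pi :: "'a::field vec set" where
  "plane_pi = {v \<in> V4. v $ 3 = 0}"

definition point_T :: "'a::field vec set" where
  "point_T = {c \<cdot>\<^sub>v unit_vec 4 3 | c. True}"

text \<open>Action of a matrix (projectivity) on subspaces.\<close>
definition act :: "'a::field mat \<Rightarrow> 'a vec set \<Rightarrow> 'a vec set" where
  "act M S = (\<lambda>v. M *\<^sub>v v) ` S"

text \<open>The group C: matrices diag(A,1) with A in the cyclic group generated by sigma.\<close>
definition groupC :: "'a::field mat \<Rightarrow> 'a mat set" where
  "groupC \<sigma> = {four_block_mat (\<sigma> ^\<^sub>m k) (0\<^sub>m 3 1) (0\<^sub>m 1 3) (1\<^sub>m 1) | k. True}"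

definition orbitC :: "'a::field mat \<Rightarrow> 'a vec set \<Rightarrow> 'a vec set set" where
  "orbitC \<sigma> S = {act g S | g. g \<in> groupC \<sigma>}"

text \<open>Lines not contained in pi and not through T.\<close>
definition lines_off :: "'a::field vec set set" where
  "lines_off = {l \<in> pg_lines. \<not> l \<subseteq> plane_pi \<and> \<not> point_T \<subseteq> l}"

text \<open>Points of PG(3,q) not in pi and different from T.\<close>
definition points_off :: "'a::field vec set set" where
  "points_off = {P \<in> pg_points. \<not> P \<subseteq> plane_pi \<and> P \<noteq> point_T}"

end

(*
  Every power of sigma lies in F[sigma] = {a sigma^2 + b sigma + c} (Cayley-Hamilton), a set of at
  most q^3 matrices which contains 0 and the q^3 - 1 distinct powers of sigma; hence its nonzero
  elements are exactly the powers of sigma. So a power of sigma with an eigenvector is a scalar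
  matrix, every nonzero scalar matrix is a power of sigma, and <sigma> acts regularly on F^3 - {0}.

  The points off pi and T are the <(x,1)> with x <> 0, on which C acts like <sigma> on F^3 - {0},
  hence semiregularly. The lines not in pi and not through T are spanned by (x,1) and (y,0) with
  x, y linearly independent. An element of C fixing such a line fixes <y>, so it is a scalar d, and
  d x = x mod y forces d = 1: every orbit has length q^3 - 1. Moving y to e1 and rescaling by scalar
  matrices brings every such line to the span of (1,0,0,0) and (0,a,b,1) with <(a,b)> a point of
  PG(1,q), and different points of PG(1,q) lie in different orbits; so there are q + 1 orbits.
*)
theory Submission
  imports Defs "Berlekamp_Zassenhaus.Berlekamp_Type_Based" "HOL-Library.Cardinality"
begin

section \<open>Matrices and vectors\<close>

lemma pow_mat_add:
  assumes "A \<in> carrier_mat n n"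
  shows "A ^\<^sub>m (i + j) = A ^\<^sub>m i * A ^\<^sub>m j"
proof (induction j)
  case 0
  show ?case using assms by simp
next
  case (Suc j)
  have "A ^\<^sub>m (i + Suc j) = A ^\<^sub>m i * A ^\<^sub>m j * A"
    using Suc by simp
  also have "\<dots> = A ^\<^sub>m i * (A ^\<^sub>m j * A)"
    using assms by (simp add: assoc_mult_mat[of _ n n _ n _ n])
  finally show ?case by simp
qed

lemma pow_mat_mult_vec_add:
  assumes "A \<in> carrier_mat n n" "x \<in> carrier_vec n"
  shows "A ^\<^sub>m i *\<^sub>v (A ^\<^sub>m j *\<^sub>v x) = A ^\<^sub>m (i + j) *\<^sub>v x"
  using assms by (simp add: pow_mat_add assoc_mult_mat_vec[of _ n n _ n])

lemma cayley_hamilton_3: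
  fixes A :: "'a::field mat"
  assumes A: "A \<in> carrier_mat 3 3"
  shows "\<exists>a b c. A * A * A = a \<cdot>\<^sub>m (A * A) + b \<cdot>\<^sub>m A + c \<cdot>\<^sub>m 1\<^sub>m 3"
proof -
  have sum3: "(\<Sum>i\<in>{0..<3::nat}. f i) = f 0 + f 1 + (f 2::'a)" for f
    by (simp add: eval_nat_numeral atLeast0_lessThan_Suc add.commute add.left_commute)
  define e where "e = (\<lambda>i j. A $$ (i,j))"
  \<comment> \<open>trace, minus the sum of the principal 2-minors, and determinant of \<open>A\<close>\<close>
  let ?a = "e 0 0 + e 1 1 + e 2 2"
  let ?b = "- (e 0 0 * e 1 1 - e 0 1 * e 1 0 + e 0 0 * e 2 2 - e 0 2 * e 2 0 + e 1 1 * e 2 2 - e 1 2 * e 2 1)"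
  let ?c = "e 0 0 * (e 1 1 * e 2 2 - e 1 2 * e 2 1) - e 0 1 * (e 1 0 * e 2 2 - e 1 2 * e 2 0)
    + e 0 2 * (e 1 0 * e 2 1 - e 1 1 * e 2 0)"
  have "A * A * A = ?a \<cdot>\<^sub>m (A * A) + ?b \<cdot>\<^sub>m A + ?c \<cdot>\<^sub>m 1\<^sub>m 3"
  proof (rule eq_matI)
    fix i j assume "i < dim_row (?a \<cdot>\<^sub>m (A * A) + ?b \<cdot>\<^sub>m A + ?c \<cdot>\<^sub>m 1\<^sub>m 3)"
      and "j < dim_col (?a \<cdot>\<^sub>m (A * A) + ?b \<cdot>\<^sub>m A + ?c \<cdot>\<^sub>m 1\<^sub>m 3)"
    then have i: "i < 3" and j: "j < 3"
      using A by auto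
    have AA: "(A * A) $$ (i, j) = e i 0 * e 0 j + e i 1 * e 1 j + e i 2 * e 2 j"
      if "i < 3" "j < 3" for i j
      using A that by (simp add: scalar_prod_def sum3 e_def)
    have AAA: "(A * A * A) $$ (i, j)
        = (A * A) $$ (i, 0) * e 0 j + (A * A) $$ (i, 1) * e 1 j + (A * A) $$ (i, 2) * e 2 j"
      using A i j by (simp add: scalar_prod_def sum3 e_def) (simp add: algebra_simps)
    have rhs: "(?a \<cdot>\<^sub>m (A * A) + ?b \<cdot>\<^sub>m A + ?c \<cdot>\<^sub>m 1\<^sub>m 3) $$ (i, j)
        = ?a * (A * A) $$ (i, j) + ?b * e i j + ?c * (if i = j then 1 else 0)"
      using A i j by (simp add: e_def)
    have "i = 0 \<or> i = 1 \<or> i = 2" "j = 0 \<or> j = 1 \<or> j = 2"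
      using i j by auto
    then show "(A * A * A) $$ (i, j) = (?a \<cdot>\<^sub>m (A * A) + ?b \<cdot>\<^sub>m A + ?c \<cdot>\<^sub>m 1\<^sub>m 3) $$ (i, j)"
      unfolding AAA rhs by (elim disjE) (simp_all add: AA algebra_simps)
  qed (use A in auto)
  then show ?thesis
    by blast
qed

lemma mult_mat_vec_zero: "A \<in> carrier_mat m n \<Longrightarrow> A *\<^sub>v 0\<^sub>v n = (0\<^sub>v m :: 'a::semiring_0 vec)"
  by (intro eq_vecI) (auto simp: scalar_prod_def)

lemma scalar_mat_mult_vec:
  assumes "x \<in> carrier_vec n"
  shows "(d \<cdot>\<^sub>m 1\<^sub>m n) *\<^sub>v x = (d::'a::field) \<cdot>\<^sub>v x"
proof -
  have "d \<cdot>\<^sub>v x = d \<cdot>\<^sub>v (1\<^sub>m n *\<^sub>v x)" using assms by simp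
  also have "\<dots> = (d \<cdot>\<^sub>m 1\<^sub>m n) *\<^sub>v x" using assms by auto
  finally show ?thesis ..
qed

lemma smult_vec_eq_zero_iff:
  assumes "v \<in> carrier_vec n"
  shows "(a::'a::field) \<cdot>\<^sub>v v = 0\<^sub>v n \<longleftrightarrow> a = 0 \<or> v = 0\<^sub>v n"
proof
  assume av: "a \<cdot>\<^sub>v v = 0\<^sub>v n"
  show "a = 0 \<or> v = 0\<^sub>v n"
  proof (cases "a = 0")
    case False
    then have "v = (1 / a) \<cdot>\<^sub>v (a \<cdot>\<^sub>v v)" by (simp add: smult_smult_assoc)
    then show ?thesis unfolding av by auto
  qed simp
qed (use assms in \<open>auto intro!: eq_vecI\<close>)

lemma less_3_iff: "(i::nat) < 3 \<longleftrightarrow> i = 0 \<or> i = 1 \<or> i = 2"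
  by auto

lemma unit_vec_neq_zero_vec: "i < n \<Longrightarrow> unit_vec n i \<noteq> (0\<^sub>v n :: 'a::zero_neq_one vec)"
  by (metis index_unit_vec(1) index_zero_vec(1) zero_neq_one)

lemma smult_zero_vec [simp]: "(a::'a::ring) \<cdot>\<^sub>v 0\<^sub>v n = 0\<^sub>v n"
  by (rule eq_vecI) auto

definition scalar_multiples :: "'a::field vec \<Rightarrow> 'a vec set" where
  "scalar_multiples v = range (\<lambda>c. c \<cdot>\<^sub>v v)"

lemma scalar_multiples_setcompr: "scalar_multiples v = {c \<cdot>\<^sub>v v | c. True}"
  unfolding scalar_multiples_def by blast

lemma self_in_scalar_multiples: "v \<in> scalar_multiples v"
  unfolding scalar_multiples_def by (metis one_smult_vec rangeI)

lemma scalar_multiples_smult: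
  assumes "a \<noteq> 0"
  shows "scalar_multiples (a \<cdot>\<^sub>v v) = scalar_multiples v"
proof -
  have "c \<cdot>\<^sub>v v = (c / a) \<cdot>\<^sub>v (a \<cdot>\<^sub>v v)" for c
    using assms by (simp add: smult_smult_assoc)
  then show ?thesis
    unfolding scalar_multiples_def by (auto simp: smult_smult_assoc simp del: times_divide_eq_left)
qed

lemma act_scalar_multiples:
  assumes "A \<in> carrier_mat m n" "v \<in> carrier_vec n"
  shows "act A (scalar_multiples v) = scalar_multiples (A *\<^sub>v v)"
  unfolding act_def scalar_multiples_def image_image using mult_mat_vec[OF assms] by simp

definition span2 :: "'a::field vec \<Rightarrow> 'a vec \<Rightarrow> 'a vec set" where
  "span2 u w = {a \<cdot>\<^sub>v u + b \<cdot>\<^sub>v w | a b. True}"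

lemma span2_change_basis:
  assumes u: "u \<in> carrier_vec n" and w: "w \<in> carrier_vec n" and det: "a * d - b * c \<noteq> 0"
  shows "span2 (a \<cdot>\<^sub>v u + b \<cdot>\<^sub>v w) (c \<cdot>\<^sub>v u + d \<cdot>\<^sub>v w) = span2 u w"
proof -
  define \<Delta> where "\<Delta> = a * d - b * c"
  have inverse_coeffs: "\<alpha> * x + \<beta> * y
      = (d * \<alpha> - c * \<beta>) / \<Delta> * (a * x + b * y) + (a * \<beta> - b * \<alpha>) / \<Delta> * (c * x + d * y)"
    for \<alpha> \<beta> x y
  proof -
    have "(d * \<alpha> - c * \<beta>) * (a * x + b * y) + (a * \<beta> - b * \<alpha>) * (c * x + d * y)
        = \<Delta> * (\<alpha> * x + \<beta> * y)"
      unfolding \<Delta>_def by (simp add: algebra_simps)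
    then show ?thesis
      using det by (simp add: \<Delta>_def add_divide_distrib[symmetric])
  qed
  have "s \<cdot>\<^sub>v (a \<cdot>\<^sub>v u + b \<cdot>\<^sub>v w) + t \<cdot>\<^sub>v (c \<cdot>\<^sub>v u + d \<cdot>\<^sub>v w)
      = (s * a + t * c) \<cdot>\<^sub>v u + (s * b + t * d) \<cdot>\<^sub>v w" for s t
    using u w by (intro eq_vecI) (auto simp: algebra_simps)
  moreover have "\<alpha> \<cdot>\<^sub>v u + \<beta> \<cdot>\<^sub>v w
      = ((d * \<alpha> - c * \<beta>) / \<Delta>) \<cdot>\<^sub>v (a \<cdot>\<^sub>v u + b \<cdot>\<^sub>v w)
        + ((a * \<beta> - b * \<alpha>) / \<Delta>) \<cdot>\<^sub>v (c \<cdot>\<^sub>v u + d \<cdot>\<^sub>v w)" for \<alpha> \<beta>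
    using u w by (intro eq_vecI) (auto simp: inverse_coeffs[of \<alpha> _ \<beta>])
  ultimately show ?thesis
    unfolding span2_def by blast
qed

lemma left_in_span2: "u \<in> carrier_vec n \<Longrightarrow> w \<in> carrier_vec n \<Longrightarrow> u \<in> span2 u w"
  unfolding span2_def by (rule CollectI, rule exI[of _ 1], rule exI[of _ 0]) auto

lemma right_in_span2: "u \<in> carrier_vec n \<Longrightarrow> w \<in> carrier_vec n \<Longrightarrow> w \<in> span2 u w"
  unfolding span2_def by (rule CollectI, rule exI[of _ 0], rule exI[of _ 1]) auto

lemma act_span2:
  assumes "A \<in> carrier_mat m n" "u \<in> carrier_vec n" "w \<in> carrier_vec n"
  shows "act A (span2 u w) = span2 (A *\<^sub>v u) (A *\<^sub>v w)"
proof -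
  have "A *\<^sub>v (a \<cdot>\<^sub>v u + b \<cdot>\<^sub>v w) = a \<cdot>\<^sub>v (A *\<^sub>v u) + b \<cdot>\<^sub>v (A *\<^sub>v w)" for a b
    using assms by (simp add: mult_add_distrib_mat_vec mult_mat_vec)
  moreover have "act A (span2 u w) = {A *\<^sub>v (a \<cdot>\<^sub>v u + b \<cdot>\<^sub>v w) | a b. True}"
    unfolding act_def span2_def by blast
  ultimately show ?thesis
    unfolding span2_def by simp
qed

lemma span2_commute:
  assumes "u \<in> carrier_vec n" "w \<in> carrier_vec n"
  shows "span2 u w = span2 w u"
proof -
  have "span2 u w \<subseteq> span2 w u" if "u \<in> carrier_vec n" "w \<in> carrier_vec n" for u w
  proof
    fix v assume "v \<in> span2 u w"
    then obtain a b where "v = a \<cdot>\<^sub>v u + b \<cdot>\<^sub>v w"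
      unfolding span2_def by blast
    also have "\<dots> = b \<cdot>\<^sub>v w + a \<cdot>\<^sub>v u"
      using that by (intro comm_add_vec) auto
    finally show "v \<in> span2 w u"
      unfolding span2_def by blast
  qed
  then show ?thesis
    using assms by blast
qed

definition extend_vec :: "'a vec \<Rightarrow> 'a \<Rightarrow> 'a vec" where
  "extend_vec x t = x @\<^sub>v vec 1 (\<lambda>_. t)"

lemma dim_extend_vec [simp]: "dim_vec (extend_vec x t) = Suc (dim_vec x)"
  unfolding extend_vec_def by simp

lemma extend_vec_carrier [simp]: "extend_vec x t \<in> carrier_vec (Suc n) \<longleftrightarrow> x \<in> carrier_vec n"
  unfolding carrier_vec_def by simp

lemmas extend_vec_carrier_4 [simp] = extend_vec_carrier[where n = 3, simplified]

lemma index_extend_vec [simp]: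
  "extend_vec x t $ dim_vec x = t"
  "i < dim_vec x \<Longrightarrow> extend_vec x t $ i = x $ i"
  unfolding extend_vec_def by simp_all

lemma extend_vec_eq_iff [simp]:
  assumes "dim_vec x = dim_vec y"
  shows "extend_vec x s = extend_vec y t \<longleftrightarrow> x = y \<and> s = t"
proof
  assume eq: "extend_vec x s = extend_vec y t"
  have "x $ i = y $ i" if "i < dim_vec y" for i
    using arg_cong[OF eq, of "\<lambda>v. v $ i"] that assms by simp
  then have "x = y"
    using assms by (intro eq_vecI) auto
  moreover have "s = t"
    using index_extend_vec(1)[of x s] index_extend_vec(1)[of y t] eq assms by metis
  ultimately show "x = y \<and> s = t" ..
qed simp

lemma smult_extend_vec: "a \<cdot>\<^sub>v extend_vec x t = extend_vec (a \<cdot>\<^sub>v x) (a * t)"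
  by (rule eq_vecI) (auto simp: extend_vec_def)

lemma add_extend_vec:
  assumes "dim_vec x = dim_vec y"
  shows "extend_vec x s + extend_vec y t = extend_vec (x + y) (s + t)"
  using assms by (intro eq_vecI) (auto simp: extend_vec_def)

lemma zero_extend_vec: "0\<^sub>v (Suc n) = extend_vec (0\<^sub>v n) 0"
  by (rule eq_vecI) (auto simp: extend_vec_def)

lemma unit_vec_extend_vec: "unit_vec (Suc n) n = extend_vec (0\<^sub>v n) 1"
  by (rule eq_vecI) (auto simp: extend_vec_def)

lemma extend_vec_vec_first:
  assumes "v \<in> carrier_vec (Suc n)"
  shows "extend_vec (vec_first v n) (v $ n) = v"
proof (rule eq_vecI)
  fix i assume "i < dim_vec v"
  then have "i < n \<or> i = n" using assms by auto
  then show "extend_vec (vec_first v n) (v $ n) $ i = v $ i"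
    using index_extend_vec[where x = "vec_first v n"] by (auto simp: vec_first_def)
qed (use assms in auto)

lemma block_diag_one_mult_extend_vec:
  assumes "(A :: 'a::semiring_1 mat) \<in> carrier_mat n n" "x \<in> carrier_vec n"
  shows "four_block_mat A (0\<^sub>m n 1) (0\<^sub>m 1 n) (1\<^sub>m 1) *\<^sub>v extend_vec x t = extend_vec (A *\<^sub>v x) t"
proof -
  have "1\<^sub>m 1 *\<^sub>v vec 1 (\<lambda>_. t) = vec 1 (\<lambda>_. t)"
    by (rule one_mult_mat_vec) simp
  then show ?thesis
    unfolding extend_vec_def using assms by (subst mult_mat_vec_split) auto
qed

lemma lin_comb_extend_vec:
  assumes "dim_vec x = dim_vec y"
  shows "a \<cdot>\<^sub>v extend_vec x s + b \<cdot>\<^sub>v extend_vec y t = extend_vec (a \<cdot>\<^sub>v x + b \<cdot>\<^sub>v y) (a * s + b * t)"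
  using assms by (simp add: smult_extend_vec add_extend_vec)

section \<open>Affine points and lines of PG(3,q)\<close>

definition affine_point :: "'a::field vec \<Rightarrow> 'a vec set" where
  "affine_point x = scalar_multiples (extend_vec x 1)"

definition affine_line :: "'a::field vec \<Rightarrow> 'a vec \<Rightarrow> 'a vec set" where
  "affine_line x y = span2 (extend_vec x 1) (extend_vec y 0)"

definition indep_pair :: "'a::field vec \<Rightarrow> 'a vec \<Rightarrow> bool" where
  "indep_pair x y \<longleftrightarrow> x \<in> carrier_vec 3 \<and> y \<in> carrier_vec 3 \<and> y \<noteq> 0\<^sub>v 3 \<and> x \<notin> scalar_multiples y"

lemma extend_vec_in_affine_point_iff:
  assumes "z \<in> carrier_vec n" "x \<in> carrier_vec n"
  shows "extend_vec z t \<in> affine_point x \<longleftrightarrow> z = t \<cdot>\<^sub>v x"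
  unfolding affine_point_def scalar_multiples_def using assms by (auto simp: smult_extend_vec)

lemma extend_vec_in_affine_line_iff:
  assumes "x \<in> carrier_vec n" "y \<in> carrier_vec n" "z \<in> carrier_vec n"
  shows "extend_vec z t \<in> affine_line x y \<longleftrightarrow> (\<exists>c. z = t \<cdot>\<^sub>v x + c \<cdot>\<^sub>v y)"
  unfolding affine_line_def span2_def using assms by (auto simp: lin_comb_extend_vec)

lemma affine_line_eq_iff:
  assumes x: "x \<in> carrier_vec n" and y: "y \<in> carrier_vec n"
    and x': "x' \<in> carrier_vec n" and y': "y' \<in> carrier_vec n" "y' \<noteq> 0\<^sub>v n"
  shows "affine_line x' y' = affine_line x y \<longleftrightarrow> (\<exists>e f. e \<noteq> 0 \<and> y' = e \<cdot>\<^sub>v y \<and> x' = x + f \<cdot>\<^sub>v y)"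
proof
  assume eq: "affine_line x' y' = affine_line x y"
  have "extend_vec y' 0 \<in> affine_line x' y'"
    unfolding affine_line_def using x' y' by (intro right_in_span2[where n = "Suc n"]) auto
  then have "extend_vec y' 0 \<in> affine_line x y"
    unfolding eq .
  then obtain e where "y' = 0 \<cdot>\<^sub>v x + e \<cdot>\<^sub>v y"
    using extend_vec_in_affine_line_iff[OF x y y'(1)] by auto
  then have "y' = e \<cdot>\<^sub>v y"
    using x y by auto
  moreover have "e \<noteq> 0"
    using y' \<open>y' = e \<cdot>\<^sub>v y\<close> y by auto
  moreover have "extend_vec x' 1 \<in> affine_line x' y'"
    unfolding affine_line_def using x' y' by (intro left_in_span2[where n = "Suc n"]) auto
  then have "extend_vec x' 1 \<in> affine_line x y"
    unfolding eq .
  then obtain f where "x' = 1 \<cdot>\<^sub>v x + f \<cdot>\<^sub>v y"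
    using extend_vec_in_affine_line_iff[OF x y x'] by auto
  ultimately show "\<exists>e f. e \<noteq> 0 \<and> y' = e \<cdot>\<^sub>v y \<and> x' = x + f \<cdot>\<^sub>v y"
    by auto
next
  assume "\<exists>e f. e \<noteq> 0 \<and> y' = e \<cdot>\<^sub>v y \<and> x' = x + f \<cdot>\<^sub>v y"
  then obtain e f where e: "e \<noteq> 0" and y'e: "y' = e \<cdot>\<^sub>v y" and x'f: "x' = x + f \<cdot>\<^sub>v y"
    by blast
  have "1 \<cdot>\<^sub>v extend_vec x 1 + f \<cdot>\<^sub>v extend_vec y 0 = extend_vec (1 \<cdot>\<^sub>v x + f \<cdot>\<^sub>v y) (1 * 1 + f * 0)"
    "0 \<cdot>\<^sub>v extend_vec x 1 + e \<cdot>\<^sub>v extend_vec y 0 = extend_vec (0 \<cdot>\<^sub>v x + e \<cdot>\<^sub>v y) (0 * 1 + e * 0)"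
    using x y by (simp_all only: lin_comb_extend_vec carrier_vecD)
  moreover have "0 \<cdot>\<^sub>v x + e \<cdot>\<^sub>v y = e \<cdot>\<^sub>v y"
    using x y by (intro eq_vecI) auto
  ultimately have new_basis: "extend_vec x' 1 = 1 \<cdot>\<^sub>v extend_vec x 1 + f \<cdot>\<^sub>v extend_vec y 0"
    "extend_vec y' 0 = 0 \<cdot>\<^sub>v extend_vec x 1 + e \<cdot>\<^sub>v extend_vec y 0"
    using x y by (simp_all add: x'f y'e)
  show "affine_line x' y' = affine_line x y"
    unfolding affine_line_def new_basis by (rule span2_change_basis[where n = "Suc n"]) (use x y e in auto)
qed

lemma span2_eq_affine_line:
  assumes u: "u \<in> carrier_vec (Suc n)" and w: "w \<in> carrier_vec (Suc n)"
    and indep: "\<forall>a b. a \<cdot>\<^sub>v u + b \<cdot>\<^sub>v w = 0\<^sub>v (Suc n) \<longrightarrow> a = 0 \<and> b = 0"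
    and u_last: "u $ n \<noteq> 0"
  shows "\<exists>x y. x \<in> carrier_vec n \<and> y \<in> carrier_vec n \<and> y \<noteq> 0\<^sub>v n \<and> span2 u w = affine_line x y"
proof -
  define u' where "u' = (1 / u $ n) \<cdot>\<^sub>v u + 0 \<cdot>\<^sub>v w"
  define w' where "w' = w $ n \<cdot>\<^sub>v u + (- u $ n) \<cdot>\<^sub>v w"
  have u': "u' \<in> carrier_vec (Suc n)" "u' $ n = 1"
    unfolding u'_def using u w u_last by auto
  have w': "w' \<in> carrier_vec (Suc n)" "w' $ n = 0"
    unfolding w'_def using u w by auto
  have "w' \<noteq> 0\<^sub>v (Suc n)"
    using indep[rule_format, of "w $ n" "- u $ n"] u_last unfolding w'_def by auto
  define x where "x = vec_first u' n"
  define y where "y = vec_first w' n"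
  have "extend_vec x 1 = u'" "extend_vec y 0 = w'"
    unfolding x_def y_def using extend_vec_vec_first u' w' by metis+
  then have "y \<noteq> 0\<^sub>v n"
    using \<open>w' \<noteq> 0\<^sub>v (Suc n)\<close> zero_extend_vec by metis
  moreover have "span2 u w = affine_line x y"
    unfolding affine_line_def \<open>extend_vec x 1 = u'\<close> \<open>extend_vec y 0 = w'\<close> u'_def w'_def
    using u w u_last by (simp add: span2_change_basis)
  ultimately show ?thesis
    unfolding x_def y_def using vec_first_carrier by blast
qed

lemma pg_line_not_in_plane_pi:
  assumes "l \<in> pg_lines" "\<not> l \<subseteq> plane_pi"
  shows "\<exists>x y. x \<in> carrier_vec 3 \<and> y \<in> carrier_vec 3 \<and> y \<noteq> 0\<^sub>v 3 \<and> l = affine_line x y"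
proof -
  obtain u w where u: "u \<in> carrier_vec 4" and w: "w \<in> carrier_vec 4"
    and indep: "\<forall>a b. a \<cdot>\<^sub>v u + b \<cdot>\<^sub>v w = 0\<^sub>v 4 \<longrightarrow> a = 0 \<and> b = 0" and l: "l = span2 u w"
    using assms(1) unfolding pg_lines_def V4_def span2_def by blast
  have "u $ 3 \<noteq> 0 \<or> w $ 3 \<noteq> 0"
  proof (rule ccontr)
    assume "\<not> (u $ 3 \<noteq> 0 \<or> w $ 3 \<noteq> 0)"
    then have "l \<subseteq> plane_pi"
      unfolding l span2_def plane_pi_def V4_def using u w by auto
    then show False using assms(2) by contradiction
  qed
  moreover have "\<forall>a b. a \<cdot>\<^sub>v w + b \<cdot>\<^sub>v u = 0\<^sub>v 4 \<longrightarrow> a = 0 \<and> b = 0"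
    using indep u w by (metis add.commute smult_carrier_vec comm_add_vec)
  ultimately show ?thesis
    using span2_eq_affine_line[of u 3 w] span2_eq_affine_line[of w 3 u] u w indep
    unfolding l span2_commute[OF w u] by auto
qed

lemma point_T_eq: "point_T = affine_point (0\<^sub>v 3)"
  unfolding point_T_def affine_point_def scalar_multiples_setcompr unit_vec_extend_vec[of 3, simplified] ..

lemma point_T_subset_affine_line_iff:
  assumes x: "x \<in> carrier_vec 3" and y: "y \<in> carrier_vec 3"
  shows "point_T \<subseteq> affine_line x y \<longleftrightarrow> x \<in> scalar_multiples y"
proof
  assume "point_T \<subseteq> affine_line x y"
  then have "extend_vec (0\<^sub>v 3) 1 \<in> affine_line x y"
    unfolding point_T_eq affine_point_def using self_in_scalar_multiples by blast
  then obtain c where "0\<^sub>v 3 = 1 \<cdot>\<^sub>v x + c \<cdot>\<^sub>v y"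
    using extend_vec_in_affine_line_iff[OF x y] by auto
  then have "x = (- c) \<cdot>\<^sub>v y"
    using x y by (auto simp: vec_eq_iff eq_neg_iff_add_eq_0)
  then show "x \<in> scalar_multiples y"
    unfolding scalar_multiples_def by blast
next
  assume "x \<in> scalar_multiples y"
  then obtain c where c: "x = c \<cdot>\<^sub>v y"
    unfolding scalar_multiples_def by blast
  show "point_T \<subseteq> affine_line x y"
  proof
    fix v :: "'a vec" assume "v \<in> point_T"
    then obtain d where "v = extend_vec (0\<^sub>v 3) d"
      unfolding point_T_eq affine_point_def scalar_multiples_def by (auto simp: smult_extend_vec)
    moreover have "0\<^sub>v 3 = d \<cdot>\<^sub>v x + (- d * c) \<cdot>\<^sub>v y"
      unfolding c using y by (auto simp: vec_eq_iff)
    then have "extend_vec (0\<^sub>v 3) d \<in> affine_line x y"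
      unfolding extend_vec_in_affine_line_iff[OF x y zero_carrier_vec] by blast
    ultimately show "v \<in> affine_line x y"
      by simp
  qed
qed

lemma affine_line_in_pg_lines:
  assumes x: "x \<in> carrier_vec 3" and y: "y \<in> carrier_vec 3" "y \<noteq> 0\<^sub>v 3"
  shows "affine_line x y \<in> pg_lines"
proof -
  have "a = 0 \<and> b = 0" if "a \<cdot>\<^sub>v extend_vec x 1 + b \<cdot>\<^sub>v extend_vec y 0 = 0\<^sub>v 4" for a b
  proof -
    have "0 \<cdot>\<^sub>v x + b \<cdot>\<^sub>v y = b \<cdot>\<^sub>v y"
      using x y by (intro eq_vecI) auto
    then have "a = 0" "b \<cdot>\<^sub>v y = 0\<^sub>v 3"
      using that x y by (auto simp: lin_comb_extend_vec zero_extend_vec[of 3, simplified] carrier_vecD)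
    then show ?thesis
      using y smult_vec_eq_zero_iff by blast
  qed
  then show ?thesis
    unfolding pg_lines_def V4_def affine_line_def span2_def using x y by fastforce
qed

lemma lines_off_eq: "lines_off = {affine_line x y | x y. indep_pair x y}"
proof
  show "lines_off \<subseteq> {affine_line x y | x y. indep_pair x y}"
  proof
    fix l assume l: "l \<in> lines_off"
    then obtain x y where x: "x \<in> carrier_vec 3" and y: "y \<in> carrier_vec 3" "y \<noteq> 0\<^sub>v 3"
      and "l = affine_line x y"
      using pg_line_not_in_plane_pi unfolding lines_off_def by blast
    moreover have "x \<notin> scalar_multiples y"
      using l point_T_subset_affine_line_iff[OF x y(1)] unfolding lines_off_def \<open>l = affine_line x y\<close>
      by blast
    ultimately show "l \<in> {affine_line x y | x y. indep_pair x y}"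
      unfolding indep_pair_def by blast
  qed
next
  show "{affine_line x y | x y. indep_pair x y} \<subseteq> lines_off"
  proof
    fix l assume "l \<in> {affine_line x y | x y. indep_pair x y}"
    then obtain x y where l: "l = affine_line x y" and "indep_pair x y"
      by blast
    then have x: "x \<in> carrier_vec 3" and y: "y \<in> carrier_vec 3" "y \<noteq> 0\<^sub>v 3"
      and xy: "x \<notin> scalar_multiples y"
      unfolding indep_pair_def by auto
    have "extend_vec x 1 \<in> affine_line x y"
      unfolding affine_line_def using x y by (intro left_in_span2[where n = 4]) auto
    moreover have "extend_vec x 1 $ 3 = 1"
      using index_extend_vec(1)[of x 1] x by simp
    ultimately have "\<not> affine_line x y \<subseteq> plane_pi"
      unfolding plane_pi_def by auto
    then show "l \<in> lines_off"
      unfolding lines_off_def l using affine_line_in_pg_lines[OF x y] point_T_subset_affine_line_iff[OF x y(1)] xy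
      by blast
  qed
qed

lemma inj_on_affine_point: "inj_on affine_point (carrier_vec n)"
proof (rule inj_onI)
  fix x y assume x: "x \<in> carrier_vec n" and y: "y \<in> carrier_vec n"
    and eq: "affine_point x = affine_point y"
  have "extend_vec x 1 \<in> affine_point x"
    unfolding affine_point_def by (rule self_in_scalar_multiples)
  then have "extend_vec x 1 \<in> affine_point y"
    unfolding eq .
  then show "x = y"
    using extend_vec_in_affine_point_iff[OF x y] by simp
qed

lemma affine_point_in_pg_points:
  assumes "x \<in> carrier_vec 3"
  shows "affine_point x \<in> pg_points"
proof -
  have "extend_vec x 1 $ 3 = 1"
    using index_extend_vec(1)[of x 1] assms by simp
  then have "extend_vec x 1 \<noteq> 0\<^sub>v 4"
    by auto
  then show ?thesis
    unfolding pg_points_def affine_point_def scalar_multiples_setcompr V4_def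
    by (intro CollectI bexI[of _ "extend_vec x 1"] conjI) (use assms in auto)
qed

lemma pg_point_not_in_plane_pi:
  assumes "P \<in> pg_points" "\<not> P \<subseteq> plane_pi"
  shows "\<exists>x \<in> carrier_vec 3. P = affine_point x"
proof -
  obtain v where v: "v \<in> carrier_vec 4" and P: "P = scalar_multiples v"
    using assms(1) unfolding pg_points_def V4_def scalar_multiples_setcompr by blast
  define t where "t = v $ 3"
  have "t \<noteq> 0"
  proof
    assume "t = 0"
    then have "P \<subseteq> plane_pi"
      unfolding P scalar_multiples_def plane_pi_def V4_def t_def using v by auto
    then show False
      using assms(2) by contradiction
  qed
  define x where "x = (1 / t) \<cdot>\<^sub>v vec_first v 3"
  have "t \<cdot>\<^sub>v extend_vec x 1 = extend_vec (vec_first v 3) (v $ 3)"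
    unfolding smult_extend_vec x_def t_def using \<open>t \<noteq> 0\<close>
    by (simp add: smult_smult_assoc t_def)
  also have "\<dots> = v"
    using v by (intro extend_vec_vec_first) simp
  finally have "P = affine_point x"
    unfolding P affine_point_def using scalar_multiples_smult[OF \<open>t \<noteq> 0\<close>, of "extend_vec x 1"]
    by simp
  then show ?thesis
    unfolding x_def by auto
qed

lemma points_off_eq: "points_off = affine_point ` (carrier_vec 3 - {0\<^sub>v 3})"
proof
  show "points_off \<subseteq> affine_point ` (carrier_vec 3 - {0\<^sub>v 3})"
  proof
    fix P assume P: "P \<in> points_off"
    then obtain x where x: "x \<in> carrier_vec 3" and "P = affine_point x"
      using pg_point_not_in_plane_pi unfolding points_off_def by blast
    moreover have "x \<noteq> 0\<^sub>v 3"
      using P \<open>P = affine_point x\<close> point_T_eq unfolding points_off_def by auto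
    ultimately show "P \<in> affine_point ` (carrier_vec 3 - {0\<^sub>v 3})"
      by auto
  qed
next
  show "affine_point ` (carrier_vec 3 - {0\<^sub>v 3}) \<subseteq> points_off"
  proof
    fix P assume "P \<in> affine_point ` (carrier_vec 3 - {0\<^sub>v 3})"
    then obtain x where x: "x \<in> carrier_vec 3" "x \<noteq> 0\<^sub>v 3" and P: "P = affine_point x"
      by blast
    have "extend_vec x 1 \<in> P" "extend_vec x 1 $ 3 = 1"
      unfolding P affine_point_def using self_in_scalar_multiples index_extend_vec(1)[of x 1] x
      by auto
    then have "\<not> P \<subseteq> plane_pi"
      unfolding plane_pi_def by auto
    moreover have "P \<noteq> point_T"
      unfolding P point_T_eq using inj_onD[OF inj_on_affine_point _ x(1) zero_carrier_vec] x(2)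
      by blast
    ultimately show "P \<in> points_off"
      unfolding points_off_def P using affine_point_in_pg_points[OF x(1)] by blast
  qed
qed

lemma card_points_off: "card (points_off :: 'a::{field,finite} vec set set) = CARD('a) ^ 3 - 1"
proof -
  have "card (points_off :: 'a vec set set) = card (carrier_vec 3 - {0\<^sub>v 3 :: 'a vec})"
    unfolding points_off_eq
    by (rule card_image) (meson Diff_subset inj_on_affine_point inj_on_subset)
  then show ?thesis
    by (simp add: card_carrier_vec)
qed

lemma act_block_affine_line:
  assumes A: "A \<in> carrier_mat n n" and x: "x \<in> carrier_vec n" and y: "y \<in> carrier_vec n"
  shows "act (four_block_mat A (0\<^sub>m n 1) (0\<^sub>m 1 n) (1\<^sub>m 1)) (affine_line x y)
    = affine_line (A *\<^sub>v x) (A *\<^sub>v y)"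
proof -
  have M: "four_block_mat A (0\<^sub>m n 1) (0\<^sub>m 1 n) (1\<^sub>m 1) \<in> carrier_mat (Suc n) (Suc n)"
    using A by auto
  have u: "extend_vec x 1 \<in> carrier_vec (Suc n)" and w: "extend_vec y 0 \<in> carrier_vec (Suc n)"
    using x y by simp_all
  show ?thesis
    unfolding affine_line_def act_span2[OF M u w] block_diag_one_mult_extend_vec[OF A x]
      block_diag_one_mult_extend_vec[OF A y] ..
qed

lemma act_block_affine_point:
  assumes A: "A \<in> carrier_mat n n" and x: "x \<in> carrier_vec n"
  shows "act (four_block_mat A (0\<^sub>m n 1) (0\<^sub>m 1 n) (1\<^sub>m 1)) (affine_point x) = affine_point (A *\<^sub>v x)"
proof -
  have M: "four_block_mat A (0\<^sub>m n 1) (0\<^sub>m 1 n) (1\<^sub>m 1) \<in> carrier_mat (Suc n) (Suc n)"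
    using A by auto
  have u: "extend_vec x 1 \<in> carrier_vec (Suc n)"
    using x by simp
  show ?thesis
    unfolding affine_point_def act_scalar_multiples[OF M u] block_diag_one_mult_extend_vec[OF A x] ..
qed

lemma act_one_mat_pg_point:
  assumes "P \<in> pg_points"
  shows "act (1\<^sub>m 4) P = P"
proof -
  have "P \<subseteq> carrier_vec 4"
    using assms unfolding pg_points_def V4_def by auto
  then have "(\<lambda>v. 1\<^sub>m 4 *\<^sub>v v) ` P = (\<lambda>v. v) ` P"
    by (intro image_cong) auto
  then show ?thesis
    unfolding act_def by simp
qed

text \<open>The \<open>q + 1\<close> orbits are indexed by the points of \<open>PG(1,q)\<close>, encoded as \<open>'a option\<close>
  with \<open>None\<close> as the point at infinity.\<close>

primrec pg1_vec :: "'a::field option \<Rightarrow> 'a vec" where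
  "pg1_vec None = vec 3 (\<lambda>i. if i = 2 then 1 else 0)"
| "pg1_vec (Some c) = vec 3 (\<lambda>i. if i = 1 then 1 else if i = 2 then c else 0)"

definition orbit_rep :: "'a::field option \<Rightarrow> 'a vec set" where
  "orbit_rep p = affine_line (pg1_vec p) (unit_vec 3 0)"

lemma dim_pg1_vec: "dim_vec (pg1_vec p) = 3"
  by (cases p) simp_all

lemma pg1_vec_carrier [simp]: "pg1_vec p \<in> carrier_vec 3"
  by (cases p) auto

lemma pg1_vec_normal_form:
  assumes X: "X \<in> carrier_vec 3" "X \<notin> scalar_multiples (unit_vec 3 0)"
  shows "\<exists>p d. d \<noteq> 0 \<and> d \<cdot>\<^sub>v X = pg1_vec p + (d * X $ 0) \<cdot>\<^sub>v unit_vec 3 0"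
proof (cases "X $ 1 = 0")
  case False
  then have "1 / X $ 1 \<cdot>\<^sub>v X = pg1_vec (Some (X $ 2 / X $ 1)) + (1 / X $ 1 * X $ 0) \<cdot>\<^sub>v unit_vec 3 0"
    using X(1) by (intro eq_vecI) (auto simp: less_3_iff)
  then show ?thesis
    using False by (metis divide_eq_0_iff one_neq_zero)
next
  case True
  have "X $ 2 \<noteq> 0"
  proof
    assume "X $ 2 = 0"
    then have "X = X $ 0 \<cdot>\<^sub>v unit_vec 3 0"
      using True X(1) by (intro eq_vecI) (auto simp: less_3_iff)
    then show False
      using X(2) unfolding scalar_multiples_def by blast
  qed
  then have "1 / X $ 2 \<cdot>\<^sub>v X = pg1_vec None + (1 / X $ 2 * X $ 0) \<cdot>\<^sub>v unit_vec 3 0"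
    using True X(1) by (intro eq_vecI) (auto simp: less_3_iff)
  then show ?thesis
    using \<open>X $ 2 \<noteq> 0\<close> by (metis divide_eq_0_iff one_neq_zero)
qed

lemma pg1_vec_eq_if_proportional:
  assumes "pg1_vec p' $ 1 = d * pg1_vec p $ 1" "pg1_vec p' $ 2 = d * pg1_vec p $ 2"
  shows "p' = p"
  using assms by (cases p; cases p') auto

lemma indep_pair_orbit_rep: "indep_pair (pg1_vec p) (unit_vec 3 0)"
proof -
  have "pg1_vec p \<noteq> c \<cdot>\<^sub>v unit_vec 3 0" for c
  proof
    assume "pg1_vec p = c \<cdot>\<^sub>v unit_vec 3 0"
    then have "pg1_vec p $ 1 = 0" "pg1_vec p $ 2 = 0"
      by simp_all
    then show False
      by (cases p) auto
  qed
  then show ?thesis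
    unfolding indep_pair_def scalar_multiples_def by (auto simp: unit_vec_neq_zero_vec)
qed

section \<open>The Singer cycle\<close>

locale singer_cycle =
  fixes \<sigma> :: "'a::{field,finite} mat" and q :: nat
  assumes card_field: "CARD('a) = q"
    and sigma_carrier: "\<sigma> \<in> carrier_mat 3 3"
    and sigma_pow_order: "\<sigma> ^\<^sub>m (q^3 - 1) = 1\<^sub>m 3"
    and sigma_pow_neq_one: "\<forall>k. 0 < k \<and> k < q^3 - 1 \<longrightarrow> \<sigma> ^\<^sub>m k \<noteq> 1\<^sub>m 3"
begin

abbreviation N :: nat where "N \<equiv> q^3 - 1"

lemma N_pos: "0 < N"
proof -
  have "card {0::'a, 1} \<le> q"
    using card_field by (metis card_mono finite subset_UNIV)
  then have "2 ^ 3 \<le> q ^ 3"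
    by (intro power_mono) auto
  then show ?thesis
    by simp
qed

lemma sigma_pow_carrier [simp]: "\<sigma> ^\<^sub>m k \<in> carrier_mat 3 3"
  using sigma_carrier by simp

lemma sigma_pow_mult_vec_carrier [simp]: "x \<in> carrier_vec 3 \<Longrightarrow> \<sigma> ^\<^sub>m k *\<^sub>v x \<in> carrier_vec 3"
  by (rule mult_mat_vec_carrier) simp_all

lemma sigma_pow_add: "\<sigma> ^\<^sub>m (i + j) = \<sigma> ^\<^sub>m i * \<sigma> ^\<^sub>m j"
  using sigma_carrier by (rule pow_mat_add)

lemma sigma_pow_N_mult: "\<sigma> ^\<^sub>m (N * t) = 1\<^sub>m 3"
proof (induction t)
  case (Suc t)
  have "\<sigma> ^\<^sub>m (N * Suc t) = \<sigma> ^\<^sub>m N * \<sigma> ^\<^sub>m (N * t)"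
    by (simp add: sigma_pow_add[symmetric])
  then show ?case
    using Suc sigma_pow_order by simp
qed (use sigma_carrier in simp)

lemma sigma_pow_mod: "\<sigma> ^\<^sub>m k = \<sigma> ^\<^sub>m (k mod N)"
proof -
  have "\<sigma> ^\<^sub>m k = \<sigma> ^\<^sub>m (N * (k div N)) * \<sigma> ^\<^sub>m (k mod N)"
    by (simp add: sigma_pow_add[symmetric])
  then show ?thesis
    unfolding sigma_pow_N_mult using left_mult_one_mat[OF sigma_pow_carrier] by simp
qed

lemma sigma_pow_mult_vec_add:
  "x \<in> carrier_vec 3 \<Longrightarrow> \<sigma> ^\<^sub>m i *\<^sub>v (\<sigma> ^\<^sub>m j *\<^sub>v x) = \<sigma> ^\<^sub>m (i + j) *\<^sub>v x"
  using sigma_carrier by (rule pow_mat_mult_vec_add)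

lemma inj_on_sigma_pow: "inj_on (\<lambda>k. \<sigma> ^\<^sub>m k) {..<N}"
proof (rule inj_onI, rule ccontr)
  have pow_diff: "\<sigma> ^\<^sub>m (j - i) = 1\<^sub>m 3" if "i < j" "j < N" "\<sigma> ^\<^sub>m i = \<sigma> ^\<^sub>m j" for i j
  proof -
    have "N - i + j = (j - i) + N"
      using that by linarith
    then have "(N - i + j) mod N = j - i"
      using that by (metis mod_add_self2 mod_less less_imp_diff_less)
    then have "\<sigma> ^\<^sub>m (j - i) = \<sigma> ^\<^sub>m (N - i) * \<sigma> ^\<^sub>m j"
      by (metis sigma_pow_add sigma_pow_mod)
    also have "\<dots> = \<sigma> ^\<^sub>m (N - i) * \<sigma> ^\<^sub>m i"
      using that(3) by simp
    also have "\<dots> = \<sigma> ^\<^sub>m N"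
      using that(1,2) by (simp flip: sigma_pow_add)
    finally show ?thesis
      using sigma_pow_order by simp
  qed
  fix i j assume "i \<in> {..<N}" "j \<in> {..<N}" "\<sigma> ^\<^sub>m i = \<sigma> ^\<^sub>m j" "i \<noteq> j"
  then obtain a b where "a < b" "b < N" "\<sigma> ^\<^sub>m a = \<sigma> ^\<^sub>m b"
    by (metis lessThan_iff linorder_neqE_nat)
  then have "\<sigma> ^\<^sub>m (b - a) = 1\<^sub>m 3" "0 < b - a" "b - a < N"
    using pow_diff by auto
  then show False
    using sigma_pow_neq_one by blast
qed

lemma sigma_pow_mult_vec_cancel:
  assumes x: "x \<in> carrier_vec 3" and z: "z \<in> carrier_vec 3"
  shows "\<sigma> ^\<^sub>m k *\<^sub>v x = \<sigma> ^\<^sub>m k *\<^sub>v z \<longleftrightarrow> x = z"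
proof
  have "k * (N - 1) + k = N * k"
    using N_pos by (cases N) (auto simp: algebra_simps)
  then have inverse: "\<sigma> ^\<^sub>m (k * (N - 1)) *\<^sub>v (\<sigma> ^\<^sub>m k *\<^sub>v v) = v" if "v \<in> carrier_vec 3" for v
    using that by (simp only: sigma_pow_mult_vec_add sigma_pow_N_mult one_mult_mat_vec)
  assume "\<sigma> ^\<^sub>m k *\<^sub>v x = \<sigma> ^\<^sub>m k *\<^sub>v z"
  then show "x = z"
    using inverse[OF x] inverse[OF z] by metis
qed simp

lemma sigma_pow_mult_vec_eq_zero_iff:
  assumes "x \<in> carrier_vec 3"
  shows "\<sigma> ^\<^sub>m k *\<^sub>v x = 0\<^sub>v 3 \<longleftrightarrow> x = 0\<^sub>v 3"
  using sigma_pow_mult_vec_cancel[OF assms zero_carrier_vec, of k]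
  by (simp add: mult_mat_vec_zero[OF sigma_pow_carrier])

definition sigma_poly :: "'a \<Rightarrow> 'a \<Rightarrow> 'a \<Rightarrow> 'a mat" where
  "sigma_poly a b c = a \<cdot>\<^sub>m (\<sigma> * \<sigma>) + b \<cdot>\<^sub>m \<sigma> + c \<cdot>\<^sub>m 1\<^sub>m 3"

lemma sigma_poly_carrier [simp]: "sigma_poly a b c \<in> carrier_mat 3 3"
  unfolding sigma_poly_def using sigma_carrier by auto

lemma index_sigma_poly:
  "i < 3 \<Longrightarrow> j < 3 \<Longrightarrow>
    sigma_poly a b c $$ (i, j) = a * (\<sigma> * \<sigma>) $$ (i, j) + b * \<sigma> $$ (i, j) + c * (if i = j then 1 else 0)"
  unfolding sigma_poly_def using sigma_carrier by simp

lemma sigma_poly_mult_sigma: "\<exists>a' b' c'. sigma_poly a b c * \<sigma> = sigma_poly a' b' c'"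
proof -
  obtain \<alpha> \<beta> \<gamma> where ch: "\<sigma> * \<sigma> * \<sigma> = \<alpha> \<cdot>\<^sub>m (\<sigma> * \<sigma>) + \<beta> \<cdot>\<^sub>m \<sigma> + \<gamma> \<cdot>\<^sub>m 1\<^sub>m 3"
    using cayley_hamilton_3[OF sigma_carrier] by blast
  have "sigma_poly a b c * \<sigma> = a \<cdot>\<^sub>m (\<sigma> * \<sigma> * \<sigma>) + b \<cdot>\<^sub>m (\<sigma> * \<sigma>) + c \<cdot>\<^sub>m \<sigma>"
    unfolding sigma_poly_def using sigma_carrier
    by (simp add: add_mult_distrib_mat[of _ 3 3] mult_smult_assoc_mat[of _ 3 3])
  also have "\<dots> = sigma_poly (a * \<alpha> + b) (a * \<beta> + c) (a * \<gamma>)"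
    unfolding ch using sigma_carrier
    by (intro eq_matI) (auto simp: index_sigma_poly carrier_matD[OF sigma_poly_carrier] algebra_simps)
  finally show ?thesis
    by blast
qed

lemma sigma_pow_eq_sigma_poly: "\<exists>a b c. \<sigma> ^\<^sub>m k = sigma_poly a b c"
proof (induction k)
  case 0
  have "\<sigma> ^\<^sub>m 0 = sigma_poly 0 0 1"
    using sigma_carrier
    by (intro eq_matI) (auto simp: index_sigma_poly carrier_matD[OF sigma_poly_carrier])
  then show ?case
    by blast
next
  case (Suc k)
  then show ?case
    using sigma_poly_mult_sigma by fastforce
qed

lemma sigma_pow_neq_zero: "\<sigma> ^\<^sub>m k \<noteq> 0\<^sub>m 3 3"
proof
  assume "\<sigma> ^\<^sub>m k = 0\<^sub>m 3 3"
  then have "\<sigma> ^\<^sub>m k *\<^sub>v unit_vec 3 0 = 0\<^sub>v 3"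
    by (intro eq_vecI) (auto simp: scalar_prod_def)
  then show False
    using unit_vec_neq_zero_vec[of 0 3] by (simp add: sigma_pow_mult_vec_eq_zero_iff)
qed

lemma range_sigma_poly: "range (\<lambda>(a, b, c). sigma_poly a b c) = insert (0\<^sub>m 3 3) ((\<lambda>k. \<sigma> ^\<^sub>m k) ` {..<N})"
proof -
  let ?K = "range (\<lambda>(a, b, c). sigma_poly a b c)"
  let ?G = "(\<lambda>k. \<sigma> ^\<^sub>m k) ` {..<N}"
  have "sigma_poly 0 0 0 = 0\<^sub>m 3 3"
    by (intro eq_matI) (auto simp: index_sigma_poly carrier_matD[OF sigma_poly_carrier])
  then have sub: "insert (0\<^sub>m 3 3) ?G \<subseteq> ?K"
    using sigma_pow_eq_sigma_poly by (auto simp: image_iff) (metis case_prod_conv)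
  have "card ?K \<le> CARD('a \<times> 'a \<times> 'a)"
    by (rule card_image_le) simp
  also have "\<dots> = N + 1"
    using card_field N_pos by (simp add: power3_eq_cube)
  also have "\<dots> = card (insert (0\<^sub>m 3 3) ?G)"
  proof -
    have "card ?G = N"
      using card_image[OF inj_on_sigma_pow] by simp
    moreover have "0\<^sub>m 3 3 \<notin> ?G"
      using sigma_pow_neq_zero by (metis imageE)
    ultimately show ?thesis
      by simp
  qed
  finally show ?thesis
    using sub by (intro card_seteq[symmetric]) auto
qed

lemma nonzero_sigma_poly_is_sigma_pow:
  assumes "sigma_poly a b c \<noteq> 0\<^sub>m 3 3"
  shows "\<exists>k. sigma_poly a b c = \<sigma> ^\<^sub>m k"
proof -
  have "sigma_poly a b c \<in> range (\<lambda>(a, b, c). sigma_poly a b c)"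
    by (metis (mono_tags) case_prod_conv rangeI)
  then show ?thesis
    unfolding range_sigma_poly using assms by auto
qed

lemma sigma_pow_eigenvector:
  assumes x: "x \<in> carrier_vec 3" "x \<noteq> 0\<^sub>v 3" and eigen: "\<sigma> ^\<^sub>m k *\<^sub>v x = d \<cdot>\<^sub>v x"
  shows "\<sigma> ^\<^sub>m k = d \<cdot>\<^sub>m 1\<^sub>m 3"
proof -
  obtain a b c where k: "\<sigma> ^\<^sub>m k = sigma_poly a b c"
    using sigma_pow_eq_sigma_poly by blast
  have M: "sigma_poly a b (c - d) = \<sigma> ^\<^sub>m k - d \<cdot>\<^sub>m 1\<^sub>m 3"
    unfolding k by (intro eq_matI) (auto simp: index_sigma_poly carrier_matD[OF sigma_poly_carrier] algebra_simps)
  have "sigma_poly a b (c - d) *\<^sub>v x = 0\<^sub>v 3"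
    unfolding M using x eigen
    by (simp add: minus_mult_distrib_mat_vec[of _ 3 3] scalar_mat_mult_vec)
  then have "sigma_poly a b (c - d) = 0\<^sub>m 3 3"
    using nonzero_sigma_poly_is_sigma_pow sigma_pow_mult_vec_eq_zero_iff x by metis
  then have "\<sigma> ^\<^sub>m k - d \<cdot>\<^sub>m 1\<^sub>m 3 = 0\<^sub>m 3 3"
    unfolding M .
  then have "(\<sigma> ^\<^sub>m k - d \<cdot>\<^sub>m 1\<^sub>m 3) $$ (i, j) = 0" if "i < 3" "j < 3" for i j
    using that by simp
  then show ?thesis
    using sigma_carrier by (intro eq_matI) auto
qed

lemma scalar_mat_is_sigma_pow:
  assumes "d \<noteq> 0"
  shows "\<exists>k. \<sigma> ^\<^sub>m k = d \<cdot>\<^sub>m 1\<^sub>m 3"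
proof -
  have "sigma_poly 0 0 d = d \<cdot>\<^sub>m 1\<^sub>m 3"
    by (intro eq_matI) (auto simp: index_sigma_poly carrier_matD[OF sigma_poly_carrier])
  moreover have "(d \<cdot>\<^sub>m 1\<^sub>m 3) $$ (0, 0) \<noteq> (0\<^sub>m 3 3 :: 'a mat) $$ (0, 0)"
    using assms by simp
  ultimately show ?thesis
    using nonzero_sigma_poly_is_sigma_pow[of 0 0 d] by metis
qed

lemma sigma_pow_fixing_vector:
  assumes "x \<in> carrier_vec 3" "x \<noteq> 0\<^sub>v 3" "\<sigma> ^\<^sub>m k *\<^sub>v x = x"
  shows "\<sigma> ^\<^sub>m k = 1\<^sub>m 3"
proof -
  have "(1::'a) \<cdot>\<^sub>m 1\<^sub>m 3 = 1\<^sub>m 3"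
    by (intro eq_matI) auto
  then show ?thesis
    using sigma_pow_eigenvector[of x k 1] assms by simp
qed

lemma bij_betw_sigma_pow_mult_vec:
  assumes x: "x \<in> carrier_vec 3" "x \<noteq> 0\<^sub>v 3"
  shows "bij_betw (\<lambda>k. \<sigma> ^\<^sub>m k *\<^sub>v x) {..<N} (carrier_vec 3 - {0\<^sub>v 3})"
proof -
  have "\<sigma> ^\<^sub>m i *\<^sub>v x \<noteq> \<sigma> ^\<^sub>m j *\<^sub>v x" if "i < j" "j < N" for i j
  proof
    assume eq: "\<sigma> ^\<^sub>m i *\<^sub>v x = \<sigma> ^\<^sub>m j *\<^sub>v x"
    have "\<sigma> ^\<^sub>m (j - i) *\<^sub>v (\<sigma> ^\<^sub>m i *\<^sub>v x) = \<sigma> ^\<^sub>m j *\<^sub>v x"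
      using x that(1) by (simp add: sigma_pow_mult_vec_add)
    then have "\<sigma> ^\<^sub>m (j - i) *\<^sub>v (\<sigma> ^\<^sub>m i *\<^sub>v x) = \<sigma> ^\<^sub>m i *\<^sub>v x"
      unfolding eq .
    then have "\<sigma> ^\<^sub>m (j - i) = 1\<^sub>m 3"
      using x by (intro sigma_pow_fixing_vector) (auto simp: sigma_pow_mult_vec_eq_zero_iff)
    then show False
      using sigma_pow_neq_one that by auto
  qed
  then have inj: "inj_on (\<lambda>k. \<sigma> ^\<^sub>m k *\<^sub>v x) {..<N}"
    by (intro inj_onI) (metis lessThan_iff linorder_neqE_nat)
  have sub: "(\<lambda>k. \<sigma> ^\<^sub>m k *\<^sub>v x) ` {..<N} \<subseteq> carrier_vec 3 - {0\<^sub>v 3}"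
    using x by (auto simp: sigma_pow_mult_vec_eq_zero_iff)
  have "card (carrier_vec 3 - {0\<^sub>v 3 :: 'a vec}) = N"
    using card_field by (simp add: card_carrier_vec)
  then have "(\<lambda>k. \<sigma> ^\<^sub>m k *\<^sub>v x) ` {..<N} = carrier_vec 3 - {0\<^sub>v 3}"
    using card_image[OF inj] by (intro card_subset_eq[OF _ sub]) auto
  then show ?thesis
    using inj by (simp add: bij_betw_def)
qed

lemma range_sigma_pow_comp: "range (\<lambda>k. f (\<sigma> ^\<^sub>m k)) = (\<lambda>k. f (\<sigma> ^\<^sub>m k)) ` {..<N}"
proof -
  have "f (\<sigma> ^\<^sub>m k) \<in> (\<lambda>k. f (\<sigma> ^\<^sub>m k)) ` {..<N}" for k
    using sigma_pow_mod[of k] N_pos by (metis image_eqI lessThan_iff mod_less_divisor)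
  then show ?thesis
    by blast
qed

lemma range_sigma_pow_shift: "range (\<lambda>k. f (\<sigma> ^\<^sub>m (k + m))) = range (\<lambda>k. f (\<sigma> ^\<^sub>m k))"
proof -
  have shift: "\<sigma> ^\<^sub>m k = \<sigma> ^\<^sub>m ((k + (N - 1) * m) + m)" for k
  proof -
    have "(k + (N - 1) * m) + m = k + N * m"
      using N_pos by (cases N) (auto simp: algebra_simps)
    then have "\<sigma> ^\<^sub>m ((k + (N - 1) * m) + m) = \<sigma> ^\<^sub>m ((k + N * m) mod N)"
      by (simp only: sigma_pow_mod[symmetric])
    also have "\<dots> = \<sigma> ^\<^sub>m k"
      by (simp add: sigma_pow_mod[of k])
    finally show ?thesis ..
  qed
  show ?thesis
  proof
    show "range (\<lambda>k. f (\<sigma> ^\<^sub>m k)) \<subseteq> range (\<lambda>k. f (\<sigma> ^\<^sub>m (k + m)))"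
    proof
      fix z assume "z \<in> range (\<lambda>k. f (\<sigma> ^\<^sub>m k))"
      then obtain k where "z = f (\<sigma> ^\<^sub>m ((k + (N - 1) * m) + m))"
        using shift by auto
      then show "z \<in> range (\<lambda>k. f (\<sigma> ^\<^sub>m (k + m)))"
        by blast
    qed
  qed auto
qed

definition C_mat :: "nat \<Rightarrow> 'a mat" where
  "C_mat k = four_block_mat (\<sigma> ^\<^sub>m k) (0\<^sub>m 3 1) (0\<^sub>m 1 3) (1\<^sub>m 1)"

lemma groupC_eq: "groupC \<sigma> = range C_mat"
  unfolding groupC_def C_mat_def by auto

lemma orbitC_affine_line:
  assumes "x \<in> carrier_vec 3" "y \<in> carrier_vec 3"
  shows "orbitC \<sigma> (affine_line x y) = range (\<lambda>k. affine_line (\<sigma> ^\<^sub>m k *\<^sub>v x) (\<sigma> ^\<^sub>m k *\<^sub>v y))"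
proof -
  have "orbitC \<sigma> (affine_line x y) = range (\<lambda>k. act (C_mat k) (affine_line x y))"
    unfolding orbitC_def groupC_eq by auto
  then show ?thesis
    unfolding C_mat_def act_block_affine_line[OF sigma_pow_carrier assms] .
qed

lemma orbitC_affine_line_lessThan:
  assumes "x \<in> carrier_vec 3" "y \<in> carrier_vec 3"
  shows "orbitC \<sigma> (affine_line x y) = (\<lambda>k. affine_line (\<sigma> ^\<^sub>m k *\<^sub>v x) (\<sigma> ^\<^sub>m k *\<^sub>v y)) ` {..<N}"
  unfolding orbitC_affine_line[OF assms]
  using range_sigma_pow_comp[of "\<lambda>A. affine_line (A *\<^sub>v x) (A *\<^sub>v y)"] by simp

lemma orbitC_affine_line_sigma_pow:
  assumes "x \<in> carrier_vec 3" "y \<in> carrier_vec 3"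
  shows "orbitC \<sigma> (affine_line (\<sigma> ^\<^sub>m m *\<^sub>v x) (\<sigma> ^\<^sub>m m *\<^sub>v y)) = orbitC \<sigma> (affine_line x y)"
  using assms range_sigma_pow_shift[of "\<lambda>A. affine_line (A *\<^sub>v x) (A *\<^sub>v y)" m]
  by (simp add: orbitC_affine_line sigma_pow_mult_vec_add)

lemma indep_pair_sigma_pow:
  assumes "indep_pair x y"
  shows "indep_pair (\<sigma> ^\<^sub>m k *\<^sub>v x) (\<sigma> ^\<^sub>m k *\<^sub>v y)"
proof -
  have x: "x \<in> carrier_vec 3" and y: "y \<in> carrier_vec 3" "y \<noteq> 0\<^sub>v 3"
    and xy: "x \<notin> scalar_multiples y"
    using assms unfolding indep_pair_def by auto
  have "\<sigma> ^\<^sub>m k *\<^sub>v x \<noteq> c \<cdot>\<^sub>v (\<sigma> ^\<^sub>m k *\<^sub>v y)" for c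
  proof
    assume "\<sigma> ^\<^sub>m k *\<^sub>v x = c \<cdot>\<^sub>v (\<sigma> ^\<^sub>m k *\<^sub>v y)"
    then have "\<sigma> ^\<^sub>m k *\<^sub>v x = \<sigma> ^\<^sub>m k *\<^sub>v (c \<cdot>\<^sub>v y)"
      using y by (simp add: mult_mat_vec[of _ 3 3])
    then have "x = c \<cdot>\<^sub>v y"
      using x y by (simp add: sigma_pow_mult_vec_cancel)
    then show False
      using xy unfolding scalar_multiples_def by blast
  qed
  then show ?thesis
    using x y unfolding indep_pair_def scalar_multiples_def by (auto simp: sigma_pow_mult_vec_eq_zero_iff)
qed

lemma affine_line_stabilizer:
  assumes "indep_pair x y"
    and "affine_line (\<sigma> ^\<^sub>m k *\<^sub>v x) (\<sigma> ^\<^sub>m k *\<^sub>v y) = affine_line x y"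
  shows "\<sigma> ^\<^sub>m k = 1\<^sub>m 3"
proof -
  have x: "x \<in> carrier_vec 3" and y: "y \<in> carrier_vec 3" "y \<noteq> 0\<^sub>v 3"
    and xy: "x \<notin> scalar_multiples y"
    using assms(1) unfolding indep_pair_def by auto
  have "\<sigma> ^\<^sub>m k *\<^sub>v y \<noteq> 0\<^sub>v 3"
    using y by (simp add: sigma_pow_mult_vec_eq_zero_iff)
  then obtain e f where e: "\<sigma> ^\<^sub>m k *\<^sub>v y = e \<cdot>\<^sub>v y" and f: "\<sigma> ^\<^sub>m k *\<^sub>v x = x + f \<cdot>\<^sub>v y"
    using assms(2) affine_line_eq_iff[OF x y(1) sigma_pow_mult_vec_carrier[OF x] sigma_pow_mult_vec_carrier[OF y(1)]]
    by blast
  have scalar: "\<sigma> ^\<^sub>m k = e \<cdot>\<^sub>m 1\<^sub>m 3"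
    using sigma_pow_eigenvector[OF y e] .
  have "e = 1"
  proof (rule ccontr)
    assume "e \<noteq> 1"
    have "e * x $ i = x $ i + f * y $ i" if "i < 3" for i
    proof -
      have "e \<cdot>\<^sub>v x = x + f \<cdot>\<^sub>v y"
        using f x by (simp add: scalar scalar_mat_mult_vec)
      then show ?thesis
        using that x y by (metis carrier_vecD index_add_vec(1) index_smult_vec(1) smult_carrier_vec)
    qed
    then have "x = (f / (e - 1)) \<cdot>\<^sub>v y"
      using x y \<open>e \<noteq> 1\<close> by (intro eq_vecI) (auto simp: field_simps)
    then show False
      using xy unfolding scalar_multiples_def by blast
  qed
  then show ?thesis
    using scalar by (intro eq_matI) auto
qed

lemma card_orbitC_affine_line:
  assumes "indep_pair x y"
  shows "card (orbitC \<sigma> (affine_line x y)) = N"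
proof -
  have x: "x \<in> carrier_vec 3" and y: "y \<in> carrier_vec 3"
    using assms unfolding indep_pair_def by auto
  let ?L = "\<lambda>k. affine_line (\<sigma> ^\<^sub>m k *\<^sub>v x) (\<sigma> ^\<^sub>m k *\<^sub>v y)"
  have "?L i \<noteq> ?L j" if "i < j" "j < N" for i j
  proof
    assume "?L i = ?L j"
    moreover have "?L j = affine_line (\<sigma> ^\<^sub>m (j - i) *\<^sub>v (\<sigma> ^\<^sub>m i *\<^sub>v x)) (\<sigma> ^\<^sub>m (j - i) *\<^sub>v (\<sigma> ^\<^sub>m i *\<^sub>v y))"
      using x y that(1) by (simp add: sigma_pow_mult_vec_add)
    ultimately have "\<sigma> ^\<^sub>m (j - i) = 1\<^sub>m 3"
      using affine_line_stabilizer[OF indep_pair_sigma_pow[OF assms]] by metis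
    then show False
      using sigma_pow_neq_one that by auto
  qed
  then have "inj_on ?L {..<N}"
    by (intro inj_onI) (metis lessThan_iff linorder_neqE_nat)
  then show ?thesis
    unfolding orbitC_affine_line_lessThan[OF x y] by (simp add: card_image)
qed

lemma orbitC_eq_orbit_rep:
  assumes "indep_pair x y"
  shows "\<exists>p. orbitC \<sigma> (affine_line x y) = orbitC \<sigma> (orbit_rep p)"
proof -
  let ?e = "unit_vec 3 0 :: 'a vec"
  have x: "x \<in> carrier_vec 3" and y: "y \<in> carrier_vec 3" "y \<noteq> 0\<^sub>v 3"
    using assms unfolding indep_pair_def by auto
  have "?e \<in> carrier_vec 3 - {0\<^sub>v 3}"
    using indep_pair_orbit_rep unfolding indep_pair_def by auto
  then have "?e \<in> (\<lambda>k. \<sigma> ^\<^sub>m k *\<^sub>v y) ` {..<N}"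
    using bij_betw_sigma_pow_mult_vec[OF y] unfolding bij_betw_def by simp
  then obtain k where k: "\<sigma> ^\<^sub>m k *\<^sub>v y = ?e"
    by auto
  define X where "X = \<sigma> ^\<^sub>m k *\<^sub>v x"
  have X: "X \<in> carrier_vec 3" "X \<notin> scalar_multiples ?e"
    using indep_pair_sigma_pow[OF assms, of k] unfolding X_def k indep_pair_def by auto
  then obtain p d where d: "d \<noteq> 0" and dX: "d \<cdot>\<^sub>v X = pg1_vec p + (d * X $ 0) \<cdot>\<^sub>v ?e"
    using pg1_vec_normal_form by blast
  obtain j where j: "\<sigma> ^\<^sub>m j = d \<cdot>\<^sub>m 1\<^sub>m 3"
    using scalar_mat_is_sigma_pow[OF d] by blast
  have "\<sigma> ^\<^sub>m (j + k) *\<^sub>v x = d \<cdot>\<^sub>v X" "\<sigma> ^\<^sub>m (j + k) *\<^sub>v y = d \<cdot>\<^sub>v ?e"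
    unfolding X_def using x y k by (simp_all add: sigma_pow_mult_vec_add[symmetric] j scalar_mat_mult_vec)
  then have "orbitC \<sigma> (affine_line x y) = orbitC \<sigma> (affine_line (pg1_vec p + (d * X $ 0) \<cdot>\<^sub>v ?e) (d \<cdot>\<^sub>v ?e))"
    using orbitC_affine_line_sigma_pow[OF x y(1), of "j + k"] dX by simp
  also have "affine_line (pg1_vec p + (d * X $ 0) \<cdot>\<^sub>v ?e) (d \<cdot>\<^sub>v ?e) = orbit_rep p"
    unfolding orbit_rep_def using d
    by (subst affine_line_eq_iff[where n = 3]) (auto simp: smult_vec_eq_zero_iff)
  finally show ?thesis ..
qed

lemma orbit_rep_inj:
  assumes "orbitC \<sigma> (orbit_rep p) = orbitC \<sigma> (orbit_rep p')"
  shows "p = p'"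
proof -
  let ?e = "unit_vec 3 0 :: 'a vec"
  have e: "?e \<in> carrier_vec 3" "?e \<noteq> 0\<^sub>v 3"
    using indep_pair_orbit_rep unfolding indep_pair_def by auto
  have "orbit_rep p' \<in> orbitC \<sigma> (orbit_rep p')"
    unfolding orbit_rep_def orbitC_affine_line[OF pg1_vec_carrier e(1)]
    by (rule range_eqI[of _ _ 0]) (simp add: sigma_carrier[THEN carrier_matD(1)])
  then have "orbit_rep p' \<in> orbitC \<sigma> (orbit_rep p)"
    unfolding assms .
  then obtain k where "affine_line (pg1_vec p') ?e = affine_line (\<sigma> ^\<^sub>m k *\<^sub>v pg1_vec p) (\<sigma> ^\<^sub>m k *\<^sub>v ?e)"
    unfolding orbit_rep_def orbitC_affine_line[OF pg1_vec_carrier e(1)] by blast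
  then obtain c f where c: "c \<noteq> 0" "?e = c \<cdot>\<^sub>v (\<sigma> ^\<^sub>m k *\<^sub>v ?e)"
    and f: "pg1_vec p' = \<sigma> ^\<^sub>m k *\<^sub>v pg1_vec p + f \<cdot>\<^sub>v (\<sigma> ^\<^sub>m k *\<^sub>v ?e)"
    using affine_line_eq_iff[of "\<sigma> ^\<^sub>m k *\<^sub>v pg1_vec p" 3 "\<sigma> ^\<^sub>m k *\<^sub>v ?e" "pg1_vec p'" ?e] e by auto
  have "(1 / c) \<cdot>\<^sub>v ?e = \<sigma> ^\<^sub>m k *\<^sub>v ?e"
    using arg_cong[OF c(2), of "\<lambda>v. (1 / c) \<cdot>\<^sub>v v"] c(1) by (simp add: smult_smult_assoc)
  then have scalar: "\<sigma> ^\<^sub>m k = (1 / c) \<cdot>\<^sub>m 1\<^sub>m 3"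
    by (intro sigma_pow_eigenvector[OF e]) simp
  have "pg1_vec p' $ 1 = 1 / c * pg1_vec p $ 1" "pg1_vec p' $ 2 = 1 / c * pg1_vec p $ 2"
    using f e(1) by (simp_all add: scalar scalar_mat_mult_vec dim_pg1_vec)
  then show ?thesis
    by (rule pg1_vec_eq_if_proportional[symmetric])
qed

lemma card_orbits_lines_off: "card {orbitC \<sigma> l | l. l \<in> lines_off} = q + 1"
proof -
  have "{orbitC \<sigma> l | l. l \<in> lines_off} = range (\<lambda>p. orbitC \<sigma> (orbit_rep p))"
    unfolding lines_off_eq orbit_rep_def
    using orbitC_eq_orbit_rep[unfolded orbit_rep_def] indep_pair_orbit_rep by blast
  moreover have "inj (\<lambda>p. orbitC \<sigma> (orbit_rep p))"
    by (rule injI) (rule orbit_rep_inj)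
  ultimately show ?thesis
    using card_field by (simp add: card_image)
qed

lemma C_mat_fixing_point_off:
  assumes "g \<in> groupC \<sigma>" "P \<in> points_off" "act g P = P"
  shows "g = 1\<^sub>m 4"
proof -
  obtain k where g: "g = C_mat k"
    using assms(1) unfolding groupC_eq by blast
  obtain x where x: "x \<in> carrier_vec 3" "x \<noteq> 0\<^sub>v 3" and P: "P = affine_point x"
    using assms(2) unfolding points_off_eq by blast
  have "affine_point (\<sigma> ^\<^sub>m k *\<^sub>v x) = affine_point x"
    using assms(3) act_block_affine_point[OF sigma_pow_carrier x(1)] unfolding g P C_mat_def by simp
  then have "\<sigma> ^\<^sub>m k *\<^sub>v x = x"
    using inj_on_affine_point[of 3] x(1) by (auto dest: inj_onD)
  then have "\<sigma> ^\<^sub>m k = 1\<^sub>m 3"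
    using sigma_pow_fixing_vector x by blast
  then show ?thesis
    unfolding g C_mat_def using four_block_one_mat[of 3 1] by simp
qed

end

theorem lemma3p4:
  fixes \<sigma> :: "'a::{field,finite} mat" and q :: nat
  assumes "card (UNIV :: 'a set) = q"
    and "\<sigma> \<in> carrier_mat 3 3" and "invertible_mat \<sigma>"
    and "\<sigma> ^\<^sub>m (q^3 - 1) = 1\<^sub>m 3"
    and "\<forall>k. 0 < k \<and> k < q^3 - 1 \<longrightarrow> \<sigma> ^\<^sub>m k \<noteq> 1\<^sub>m 3"
  shows "card {orbitC \<sigma> l | l. l \<in> (lines_off :: 'a vec set set)} = q + 1
       \<and> (\<forall>l \<in> (lines_off :: 'a vec set set). card (orbitC \<sigma> l) = q^3 - 1)
       \<and> card (points_off :: 'a vec set set) = q^3 - 1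
       \<and> (\<forall>g \<in> groupC \<sigma>. \<forall>P \<in> (points_off :: 'a vec set set). act g P = P \<longrightarrow>
             (\<forall>Q \<in> (pg_points :: 'a vec set set). act g Q = Q))"
proof -
  interpret singer_cycle \<sigma> q
    using assms by unfold_locales auto
  have "card (orbitC \<sigma> l) = q^3 - 1" if "l \<in> lines_off" for l
    using that card_orbitC_affine_line unfolding lines_off_eq by blast
  moreover have "act g Q = Q" if "g \<in> groupC \<sigma>" "P \<in> points_off" "act g P = P" "Q \<in> pg_points" for g P Q
    using C_mat_fixing_point_off[OF that(1-3)] act_one_mat_pg_point[OF that(4)] by simp
  ultimately show ?thesis
    using card_orbits_lines_off card_points_off assms(1) by blast
qed

end
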